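(* Let $\delta>0$, $\epsilon>0$, and let $M,N\ge1$ with $M\asymp N$ (i.e. $C_1N\le M\le C_2N$ for fixed $C_1,C_2>0$). Then for $q\in\mathbf{N}$ with $q\le N^{2-\delta}$ and every $k\mid q$, \[ \sum_{\substack{1\le r\le q\\ (r,q)=k}}\Big(\sum_{m\equiv r\ (\mathrm{mod}\ q)}\tau_{M,N}(m)-\frac{MN}{q^2}\sum_{d\mid k}\sum_{c\mid \frac{q}{d}}dc\,\mu\Big(\frac{q}{dc}\Big)\Big)^2\ll\frac{N^{\max(7/2,\,4-\delta)+\epsilon}}{q}, \] uniformly in $q$ and $k$, the implied constant depending on $\delta,\epsilon,C_1,C_2$.
   Context: $\tau_{M,N}(m)=\#\{(a,b)\in\mathbf{N}^2: a\le M,\ b\le N,\ ab=m\}$; $m$ ranges over positive integers; $\mu$ is the Möbius function. *)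

theory Defs
  imports
    "HOL-Analysis.Analysis"
    "HOL-Number_Theory.Number_Theory"
    "HOL-Computational_Algebra.Squarefree"
begin

definition moebius_mu :: "nat \<Rightarrow> int" where
  "moebius_mu n = (if squarefree n then (- 1) ^ card (prime_factors n) else 0)"

definition restricted_divisor_count :: "real \<Rightarrow> real \<Rightarrow> nat \<Rightarrow> nat" where
  "restricted_divisor_count M N m =
     card {(a :: nat, b :: nat). 0 < a \<and> 0 < b \<and> real a \<le> M \<and> real b \<le> N \<and> a * b = m}"

text \<open>The infinite sum below has only finitely many nonzero terms, since
  \<^term>\<open>restricted_divisor_count M N m\<close> vanishes for \<open>m > M * N\<close>.\<close>

definition divisor_progression_sum :: "real \<Rightarrow> real \<Rightarrow> nat \<Rightarrow> nat \<Rightarrow> real" where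
  "divisor_progression_sum M N q r =
     (\<Sum>\<^sub>\<infinity>m\<in>{m. 0 < m \<and> [m = r] (mod q)}. real (restricted_divisor_count M N m))"

definition divisor_progression_main :: "real \<Rightarrow> real \<Rightarrow> nat \<Rightarrow> nat \<Rightarrow> real" where
  "divisor_progression_main M N q k =
     M * N / (real q)\<^sup>2 *
       (\<Sum>d\<in>{d. d dvd k}. \<Sum>c\<in>{c. c dvd q div d}.
          real d * real c * of_int (moebius_mu (q div (d * c))))"

end

theory Submission
  imports Defs "HOL-Library.Centered_Division"
begin

text \<open>
  The main term is a multiple of \<open>\<Sum>d | gcd(r, q). d \<phi>(q / d)\<close>, so its Fourier transform on the
  residues modulo \<open>q\<close> is \<open>M N gcd(h, q) / q\<close>. By Parseval, the sum over \<open>all\<close> residues \<open>r\<close> equals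
  \<open>1/q \<Sum>\<^sub>h |\<Sum>\<^sub>a \<Sum>\<^sub>b e(a b h / q) - M N gcd(h, q) / q|\<^sup>2\<close>. The \<open>a\<close> with \<open>q | a h\<close> reproduce the main
  term up to \<open>O(M + N)\<close>. For the others let \<open>u \<equiv> a h\<close> be the residue of least absolute value: the
  sum over \<open>b\<close> is at most \<open>w(u) = min(N, q / |u|)\<close>, and opening the square leaves a sum of \<open>w(u) w(u')\<close>
  over triples \<open>(h, a, a')\<close>. They satisfy \<open>a' u \<equiv> a u'\<close>, so given \<open>(a, u')\<close> the product \<open>a' u\<close> lies in
  a fixed residue class. The divisor function bounds the number of \<open>(a', u)\<close> with a given product,
  the weights \<open>w\<close> add up to harmonic sums, and then \<open>h\<close> has at most \<open>gcd(a, q)\<close> values. The total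
  is \<open>O(N\<^bsup>2+\<epsilon>\<^esup>)\<close>, which is at most \<open>N\<^bsup>4-\<delta>+\<epsilon>\<^esup> / q\<close> for \<open>q \<le> N\<^bsup>2-\<delta>\<^esup>\<close>.
\<close>

section \<open>Divisor sums and the divisor function\<close>

lemma moebius_mu_prime_mult:
  assumes "prime p" "\<not> p dvd d"
  shows "moebius_mu (p * d) = - moebius_mu d"
proof -
  have "d \<noteq> 0"
    using assms(2) by (metis dvd_0_right)
  then have "prime_factors (p * d) = insert p (prime_factors d)"
    using assms(1) by (simp add: prime_factors_product prime_prime_factors)
  moreover have "squarefree (p * d) \<longleftrightarrow> squarefree d"
    using assms by (metis prime_imp_coprime squarefree_mult_coprime squarefree_multD(2) squarefree_prime)
  ultimately show ?thesis
    using assms(2) by (simp add: moebius_mu_def in_prime_factors_iff)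
qed

lemma sum_moebius_mu_divisors:
  assumes "n > 0"
  shows "(\<Sum>d | d dvd n. moebius_mu d) = (if n = 1 then 1 else 0)"
proof (cases "n = 1")
  case True
  then show ?thesis by (simp add: moebius_mu_def)
next
  case False
  then obtain p where p_prime_dvd: "prime p" "p dvd n"
    using prime_factor_nat by blast
  define D where "D = {d. d dvd n \<and> squarefree d}"
  define toggle where "toggle d = (if p dvd d then d div p else p * d)" for d
  have not_dvd: "\<not> p dvd d div p" if "d \<in> D" "p dvd d" for d
    using that p_prime_dvd(1) unfolding D_def
    by (metis (no_types, lifting) dvd_mult_div_cancel mem_Collect_eq mult_dvd_mono not_prime_unit
        power2_eq_square squarefree_def dvd_refl)
  have toggle_toggle: "toggle (toggle d) = d" if "d \<in> D" for d
    using not_dvd[OF that] p_prime_dvd(1) by (auto simp: toggle_def)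
  have quotient_dvd: "d div p dvd d" if "p dvd d" for d
    using that by (metis dvd_div_mult_self dvd_triv_left)
  have toggle_mem: "toggle d \<in> D" if "d \<in> D" for d
    using that p_prime_dvd dvd_trans[OF quotient_dvd] squarefree_mono[OF quotient_dvd]
    by (auto simp: toggle_def D_def divides_mult prime_imp_coprime squarefree_mult_coprime squarefree_prime)
  have moebius_toggle: "moebius_mu (toggle d) = - moebius_mu d" if "d \<in> D" for d
    using moebius_mu_prime_mult[OF p_prime_dvd(1), of d]
      moebius_mu_prime_mult[OF p_prime_dvd(1) not_dvd[OF that]]
    by (auto simp: toggle_def)
  have "(\<Sum>d\<in>D. moebius_mu d) = (\<Sum>d\<in>D. - moebius_mu d)"
    by (rule sum.reindex_bij_witness[of _ toggle toggle])
      (auto simp: toggle_toggle toggle_mem moebius_toggle)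
  then have "(\<Sum>d\<in>D. moebius_mu d) = 0"
    by (simp add: sum_negf)
  moreover have "(\<Sum>d | d dvd n. moebius_mu d) = (\<Sum>d\<in>D. moebius_mu d)"
    using assms unfolding D_def by (intro sum.mono_neutral_right) (auto simp: moebius_mu_def)
  ultimately show ?thesis
    using False by simp
qed

lemma moebius_inversion:
  fixes f :: "nat \<Rightarrow> 'a :: comm_ring_1"
  assumes "n > 0"
  shows "(\<Sum>c | c dvd n. (\<Sum>d | d dvd c. f d) * of_int (moebius_mu (n div c))) = f n"
proof -
  have fin: "finite {d. d dvd m}" if "m dvd n" for m
    using that assms by (auto intro: finite_divisors_nat dvd_pos_nat)
  have "(\<Sum>c | c dvd n. (\<Sum>d | d dvd c. f d) * of_int (moebius_mu (n div c))) =
        (\<Sum>(c, d)\<in>(SIGMA c:{c. c dvd n}. {d. d dvd c}). f d * of_int (moebius_mu (n div c)))"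
    using fin by (simp add: sum_distrib_right sum.Sigma)
  also have "\<dots> = (\<Sum>(d, e)\<in>(SIGMA d:{d. d dvd n}. {e. e dvd n div d}). f d * of_int (moebius_mu e))"
    using assms
    by (intro sum.reindex_bij_witness[of _ "\<lambda>(d, e). (n div e, d)" "\<lambda>(c, d). (d, n div c)"])
      (auto elim!: dvdE simp: div_mult2_eq)
  also have "\<dots> = (\<Sum>d | d dvd n. f d * of_int (\<Sum>e | e dvd n div d. moebius_mu e))"
    using fin by (subst sum.Sigma[symmetric]) (auto simp: sum_distrib_left div_dvd_iff_mult)
  also have "\<dots> = (\<Sum>d | d dvd n. if d = n then f n else 0)"
  proof (intro sum.cong refl)
    fix d assume "d \<in> {d. d dvd n}"
    then have "n div d > 0" "n div d = 1 \<longleftrightarrow> d = n"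
      using assms by (auto elim!: dvdE)
    then show "f d * of_int (\<Sum>e | e dvd n div d. moebius_mu e) = (if d = n then f n else 0)"
      using sum_moebius_mu_divisors[of "n div d"] by auto
  qed
  also have "\<dots> = f n"
    using fin[of n] by simp
  finally show ?thesis .
qed

lemma totient_eq_sum_moebius_mu:
  assumes "n > 0"
  shows "real (totient n) = (\<Sum>c | c dvd n. real c * of_int (moebius_mu (n div c)))"
proof -
  have "(\<Sum>d | d dvd c. real (totient d)) = real c" for c
    using arg_cong[OF totient_divisor_sum[of c], of real] by simp
  then show ?thesis
    using moebius_inversion[OF assms, of "\<lambda>d. real (totient d)"] by simp
qed

definition divisor_count :: "nat \<Rightarrow> nat" where
  "divisor_count n = card {d. d dvd n}"

lemma divisor_count_le_prod_multiplicity: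
  assumes "n > 0"
  shows "divisor_count n \<le> (\<Prod>p\<in>prime_factors n. Suc (multiplicity p n))"
proof -
  let ?exponents = "\<lambda>d. \<lambda>p\<in>prime_factors n. multiplicity p d"
  have "inj_on ?exponents {d. d dvd n}"
  proof (rule inj_onI)
    fix d e assume divisors: "d \<in> {d. d dvd n}" "e \<in> {d. d dvd n}" and eq: "?exponents d = ?exponents e"
    show "d = e"
    proof (rule multiplicity_eq_nat)
      fix p :: nat assume "prime p"
      show "multiplicity p d = multiplicity p e"
      proof (cases "p dvd n")
        case True
        then have "p \<in> prime_factors n"
          using \<open>prime p\<close> assms by (simp add: in_prime_factors_iff)
        then show ?thesis
          using fun_cong[OF eq, of p] by simp
      next
        case False
        then have "\<not> p dvd d" "\<not> p dvd e"
          using divisors dvd_trans by blast+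
        then show ?thesis
          by (simp add: not_dvd_imp_multiplicity_0)
      qed
    qed (use divisors assms in \<open>auto intro: dvd_pos_nat\<close>)
  qed
  moreover have "?exponents ` {d. d dvd n} \<subseteq> (\<Pi>\<^sub>E p\<in>prime_factors n. {..multiplicity p n})"
    using assms by (auto simp: dvd_imp_multiplicity_le)
  ultimately have "divisor_count n \<le> card (\<Pi>\<^sub>E p\<in>prime_factors n. {..multiplicity p n})"
    unfolding divisor_count_def by (intro card_inj_on_le finite_PiE) auto
  then show ?thesis
    by (simp add: card_PiE)
qed

lemma Suc_le_power_powr:
  fixes x \<eta> :: real
  assumes "\<eta> > 0" "x \<ge> 2 powr (1 / \<eta>)"
  shows "real (Suc a) \<le> (x ^ a) powr \<eta>"
proof -
  have "x > 0"
    using assms(2) by (smt (verit) powr_gt_zero)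
  have "real (Suc a) \<le> 2 ^ a"
    using less_exp[of a] by (metis Suc_leI of_nat_le_iff of_nat_numeral of_nat_power)
  also have "2 = (2 powr (1 / \<eta>)) powr \<eta>"
    using assms(1) by (simp add: powr_powr)
  also have "\<dots> ^ a \<le> (x powr \<eta>) ^ a"
    using assms by (intro power_mono powr_mono2) auto
  also have "\<dots> = (x ^ a) powr \<eta>"
    using \<open>x > 0\<close> by (simp add: powr_power powr_powr mult.commute flip: powr_realpow)
  finally show ?thesis by simp
qed

lemma Suc_le_const_mult_power_powr:
  fixes x \<eta> :: real
  assumes "\<eta> > 0" "x \<ge> 2"
  shows "real (Suc a) \<le> (1 + 1 / (\<eta> * ln 2)) * (x ^ a) powr \<eta>"
proof -
  have "real (Suc a) \<le> (1 + 1 / (\<eta> * ln 2)) * (1 + real a * (\<eta> * ln 2))"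
    using assms(1) by (simp add: field_simps)
  also have "1 + real a * (\<eta> * ln 2) \<le> exp (real a * (\<eta> * ln 2))"
    by (rule exp_ge_add_one_self)
  also have "\<dots> = (2 ^ a) powr \<eta>"
    by (simp add: powr_def ln_realpow mult_ac)
  also have "\<dots> \<le> (x ^ a) powr \<eta>"
    using assms by (intro powr_mono2 power_mono) auto
  finally show ?thesis
    using assms(1) by (simp add: mult_left_mono)
qed

lemma divisor_count_powr_bound:
  fixes \<eta> :: real
  assumes "\<eta> > 0"
  shows "\<exists>C. \<forall>n>0. real (divisor_count n) \<le> C * real n powr \<eta>"
proof -
  define P where "P = nat \<lceil>2 powr (1 / \<eta>)\<rceil>"
  define K where "K = 1 + 1 / (\<eta> * ln 2)"
  have K_ge_1: "K \<ge> 1"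
    using assms by (simp add: K_def)
  have local_bound: "real (Suc a) \<le> (if p < P then K else 1) * (real p ^ a) powr \<eta>"
    if "prime p" for p a :: nat
    using Suc_le_const_mult_power_powr[OF assms, of "real p" a] Suc_le_power_powr[OF assms, of "real p" a]
      prime_ge_2_nat[OF that]
    by (auto simp: K_def P_def not_less ceiling_le_iff nat_le_iff)
  have "real (divisor_count n) \<le> K ^ P * real n powr \<eta>" if "n > 0" for n
  proof -
    have "card {p \<in> prime_factors n. p < P} \<le> card {..<P}"
      by (intro card_mono) auto
    then have small_primes: "(\<Prod>p\<in>prime_factors n. if p < P then K else 1) \<le> K ^ P"
      using K_ge_1 by (simp add: power_increasing flip: prod.inter_filter)
    have "real (divisor_count n) \<le> (\<Prod>p\<in>prime_factors n. real (Suc (multiplicity p n)))"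
      using divisor_count_le_prod_multiplicity[OF that] by (metis of_nat_le_iff of_nat_prod)
    also have "\<dots> \<le> (\<Prod>p\<in>prime_factors n. (if p < P then K else 1) * (real p ^ multiplicity p n) powr \<eta>)"
      by (intro prod_mono conjI local_bound) auto
    also have "\<dots> = (\<Prod>p\<in>prime_factors n. if p < P then K else 1) *
        real (\<Prod>p\<in>prime_factors n. p ^ multiplicity p n) powr \<eta>"
      by (simp add: prod.distrib prod_powr_distrib)
    also have "(\<Prod>p\<in>prime_factors n. p ^ multiplicity p n) = n"
      using prime_factorization_nat[OF that] by simp
    also have "(\<Prod>p\<in>prime_factors n. if p < P then K else 1) * real n powr \<eta> \<le> K ^ P * real n powr \<eta>"
      using small_primes by (rule mult_right_mono) simp
    finally show ?thesis .
  qed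
  then show ?thesis by blast
qed

lemma harm_le_powr:
  fixes \<eta> :: real
  assumes "\<eta> > 0" "n > 0"
  shows "harm n \<le> (1 + 1 / \<eta>) * real n powr \<eta>"
proof -
  have "harm n \<le> 1 + ln (real n)"
    using euler_mascheroni_sequence_decreasing[of 1 n] assms(2) by (simp add: harm_expand)
  also have "ln (real n) \<le> real n powr \<eta> / \<eta>"
    using assms by (intro ln_powr_bound) auto
  also have "1 \<le> real n powr \<eta>"
    using assms by (intro ge_one_powr_ge_zero) auto
  finally show ?thesis
    by (simp add: algebra_simps)
qed

lemma divisor_count_harm_powr_bound:
  fixes \<eta> :: real
  assumes "\<eta> > 0"
  shows "\<exists>C\<ge>1. \<forall>n>0. real (divisor_count n) \<le> C * real n powr \<eta> \<and> harm n \<le> C * real n powr \<eta>"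
proof -
  obtain C where C_bound: "\<And>n. n > 0 \<Longrightarrow> real (divisor_count n) \<le> C * real n powr \<eta>"
    using divisor_count_powr_bound[OF assms] by blast
  show ?thesis
  proof (intro exI[of _ "max C (1 + 1 / \<eta>)"] conjI allI impI)
    show "1 \<le> max C (1 + 1 / \<eta>)"
      using assms by (simp add: le_max_iff_disj)
  next
    fix n :: nat assume "n > 0"
    show "real (divisor_count n) \<le> max C (1 + 1 / \<eta>) * real n powr \<eta>"
      by (rule order.trans[OF C_bound[OF \<open>n > 0\<close>]]) (simp add: mult_right_mono)
    show "harm n \<le> max C (1 + 1 / \<eta>) * real n powr \<eta>"
      by (rule order.trans[OF harm_le_powr[OF assms \<open>n > 0\<close>]]) (simp add: mult_right_mono)
  qed
qed

section \<open>Additive characters\<close>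

definition additive_char :: "nat \<Rightarrow> int \<Rightarrow> complex" where
  "additive_char q x = cis (2 * pi * real_of_int x / real q)"

lemma norm_additive_char [simp]: "norm (additive_char q x) = 1"
  by (simp add: additive_char_def)

lemma additive_char_add: "additive_char q (x + y) = additive_char q x * additive_char q y"
  by (simp add: additive_char_def cis_mult ring_distribs add_divide_distrib)

lemma cnj_additive_char: "cnj (additive_char q x) = additive_char q (- x)"
  by (simp add: additive_char_def cis_cnj)

lemma additive_char_mult_of_nat: "additive_char q (x * int n) = additive_char q x ^ n"
  by (simp add: additive_char_def Complex.DeMoivre mult_ac)

lemma additive_char_mult_left_cancel:
  assumes "d > 0"
  shows "additive_char (d * e) (int d * x) = additive_char e x"
  using assms by (simp add: additive_char_def mult.left_commute[of _ "real d"])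

lemma additive_char_eq_1_iff:
  assumes "q > 0"
  shows "additive_char q x = 1 \<longleftrightarrow> int q dvd x"
proof -
  have "additive_char q x = 1 \<longleftrightarrow> (\<exists>n::int. 2 * pi * real_of_int x / real q = of_int (2 * n) * pi)"
    by (simp add: additive_char_def cis_conv_exp exp_eq_1)
  also have "\<dots> \<longleftrightarrow> (\<exists>n. real_of_int x = real_of_int (int q * n))"
    using assms by (simp add: field_simps)
  also have "\<dots> \<longleftrightarrow> int q dvd x"
    unfolding of_int_eq_iff by (simp add: dvd_def)
  finally show ?thesis .
qed

lemma additive_char_cong:
  assumes "[x = y] (mod int q)" "q > 0"
  shows "additive_char q x = additive_char q y"
proof -
  have "additive_char q x = additive_char q (x - y) * additive_char q y"
    by (simp flip: additive_char_add)
  also have "additive_char q (x - y) = 1"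
    using assms by (simp add: additive_char_eq_1_iff cong_iff_dvd_diff)
  finally show ?thesis by simp
qed

lemma sum_additive_char:
  assumes "q > 0"
  shows "(\<Sum>r<q. additive_char q (x * int r)) = (if int q dvd x then of_nat q else 0)"
proof -
  have "additive_char q x ^ q = 1"
    using assms by (simp add: additive_char_eq_1_iff flip: additive_char_mult_of_nat)
  then show ?thesis
    using assms by (simp add: additive_char_mult_of_nat sum_gp_strict additive_char_eq_1_iff)
qed

definition residue_fourier :: "nat \<Rightarrow> (nat \<Rightarrow> complex) \<Rightarrow> nat \<Rightarrow> complex" where
  "residue_fourier q f h = (\<Sum>r<q. f r * additive_char q (int h * int r))"

lemma residue_fourier_diff:
  "residue_fourier q (\<lambda>r. f r - g r) h = residue_fourier q f h - residue_fourier q g h"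
  by (simp add: residue_fourier_def left_diff_distrib sum_subtractf)

lemma residue_fourier_sum:
  "residue_fourier q (\<lambda>r. \<Sum>i\<in>I. c i * f i r) h = (\<Sum>i\<in>I. c i * residue_fourier q (f i) h)"
  unfolding residue_fourier_def sum_distrib_left sum_distrib_right
  by (subst sum.swap) (simp add: mult.assoc)

theorem residue_fourier_parseval:
  assumes "q > 0"
  shows "(\<Sum>h<q. (norm (residue_fourier q f h))\<^sup>2) = real q * (\<Sum>r<q. (norm (f r))\<^sup>2)"
proof -
  let ?e = "additive_char q"
  have orthogonality: "(\<Sum>h<q. ?e ((int r - int s) * int h)) = (if s = r then of_nat q else 0)"
    if "r < q" "s < q" for r s
  proof -
    have "int q dvd int r - int s \<longleftrightarrow> s = r"
      using that by (auto simp: cong_def simp flip: cong_iff_dvd_diff zmod_int)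
    then show ?thesis
      by (simp add: sum_additive_char[OF assms])
  qed
  have "complex_of_real (\<Sum>h<q. (norm (residue_fourier q f h))\<^sup>2) =
        (\<Sum>h<q. residue_fourier q f h * cnj (residue_fourier q f h))"
    by (simp add: complex_norm_square flip: of_real_power)
  also have "\<dots> = (\<Sum>h<q. \<Sum>r<q. \<Sum>s<q. f r * cnj (f s) * ?e ((int r - int s) * int h))"
    by (simp add: residue_fourier_def sum_product cnj_additive_char mult_ac flip: additive_char_add)
       (simp add: algebra_simps flip: additive_char_add)
  also have "\<dots> = (\<Sum>r<q. \<Sum>s<q. \<Sum>h<q. f r * cnj (f s) * ?e ((int r - int s) * int h))"
    by (subst sum.swap, rule sum.cong[OF refl], rule sum.swap)
  also have "\<dots> = (\<Sum>r<q. \<Sum>s<q. if s = r then f r * cnj (f r) * of_nat q else 0)"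
    by (intro sum.cong refl) (auto simp: orthogonality simp flip: sum_distrib_left)
  also have "\<dots> = complex_of_real (real q * (\<Sum>r<q. (norm (f r))\<^sup>2))"
    by (simp add: complex_norm_square sum_distrib_left mult_ac flip: of_real_power)
  finally show ?thesis
    by (simp only: of_real_eq_iff)
qed

lemma residue_fourier_card_cong:
  assumes "q > 0" "finite P"
  shows "residue_fourier q (\<lambda>r. of_nat (card {p \<in> P. [g p = r] (mod q)})) h =
           (\<Sum>p\<in>P. additive_char q (int h * int (g p)))"
proof -
  have "residue_fourier q (\<lambda>r. of_nat (card {p \<in> P. [g p = r] (mod q)})) h =
        (\<Sum>r<q. \<Sum>p\<in>P. if g p mod q = r then additive_char q (int h * int r) else 0)"
    using assms(2) by (simp add: residue_fourier_def cong_def flip: sum.inter_filter)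
  also have "\<dots> = (\<Sum>p\<in>P. \<Sum>r<q. if g p mod q = r then additive_char q (int h * int r) else 0)"
    by (rule sum.swap)
  also have "\<dots> = (\<Sum>p\<in>P. additive_char q (int h * int (g p)))"
  proof (intro sum.cong refl)
    fix p
    have "additive_char q (int h * int (g p mod q)) = additive_char q (int h * int (g p))"
      using assms(1) by (intro additive_char_cong cong_mult cong_refl) (simp_all add: zmod_int)
    then show "(\<Sum>r<q. if g p mod q = r then additive_char q (int h * int r) else 0) =
                 additive_char q (int h * int (g p))"
      using assms(1) by simp
  qed
  finally show ?thesis .
qed

lemma residue_fourier_multiples:
  assumes "q > 0" "d dvd q"
  shows "residue_fourier q (\<lambda>r. of_bool (d dvd r)) h =
           (if q div d dvd h then of_nat (q div d) else 0)"
proof -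
  define e where "e = q div d"
  have q_eq: "q = d * e" "d > 0" "e > 0"
    using assms by (auto simp: e_def elim!: dvdE)
  have "residue_fourier q (\<lambda>r. of_bool (d dvd r)) h =
        (\<Sum>r\<in>{r\<in>{..<q}. d dvd r}. additive_char q (int h * int r))"
    unfolding residue_fourier_def by (intro sum.mono_neutral_cong_right) auto
  also have "\<dots> = (\<Sum>s<e. additive_char (d * e) (int d * (int h * int s)))"
    using q_eq by (intro sum.reindex_bij_witness[of _ "\<lambda>s. d * s" "\<lambda>r. r div d"])
      (auto simp: mult_ac less_mult_imp_div_less)
  also have "\<dots> = (\<Sum>s<e. additive_char e (int h * int s))"
    by (simp only: additive_char_mult_left_cancel[OF q_eq(2)])
  also have "\<dots> = (if e dvd h then of_nat e else 0)"
    using sum_additive_char[OF q_eq(3), of "int h"] by simp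
  finally show ?thesis by (simp add: e_def)
qed

lemma jordan_inequality:
  fixes x :: real
  assumes "0 \<le> x" "x \<le> pi / 2"
  shows "2 / pi * x \<le> sin x"
proof -
  have "concave_on {0..pi / 2} sin"
  proof (rule f''_le0_imp_concave)
    fix x :: real assume "x \<in> {0..pi / 2}"
    then show "- sin x \<le> 0"
      by (auto intro: sin_ge_zero)
  qed (auto intro!: derivative_eq_intros)
  then have "(1 - 2 / pi * x) * sin 0 + 2 / pi * x * sin (pi / 2) \<le>
             sin ((1 - 2 / pi * x) *\<^sub>R 0 + (2 / pi * x) *\<^sub>R (pi / 2))"
    using assms by (intro concave_onD) (auto simp: field_simps)
  then show ?thesis by simp
qed

lemma norm_additive_char_minus_1_ge:
  assumes "q > 0" "2 * \<bar>x\<bar> \<le> int q"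
  shows "norm (additive_char q x - 1) \<ge> 4 * real_of_int \<bar>x\<bar> / real q"
proof -
  let ?y = "pi * real_of_int \<bar>x\<bar> / real q"
  have "2 * real_of_int \<bar>x\<bar> \<le> real q"
    using assms(2) by linarith
  then have "?y \<le> pi / 2"
    using assms(1) by (simp add: field_simps)
  then have "2 / pi * ?y \<le> sin ?y"
    by (intro jordan_inequality) auto
  also have "\<dots> \<le> \<bar>sin (pi * real_of_int x / real q)\<bar>"
    by (cases "x \<ge> 0") auto
  also have "2 * \<dots> = norm (additive_char q x - 1)"
    using dist_exp_i_1[of "2 * pi * real_of_int x / real q"]
    by (simp add: additive_char_def cis_conv_exp)
  finally show ?thesis by simp
qed

text \<open>
  This is \<open>min T (y / k)\<close>, where \<^term>\<open>y / 0\<close> has to be read as infinity, so that it is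
  antitone in \<open>k\<close>.
\<close>

definition truncated_reciprocal :: "real \<Rightarrow> real \<Rightarrow> nat \<Rightarrow> real" where
  "truncated_reciprocal T y k = (if k = 0 then T else min T (y / real k))"

lemma truncated_reciprocal_nonneg: "0 \<le> T \<Longrightarrow> 0 \<le> y \<Longrightarrow> 0 \<le> truncated_reciprocal T y k"
  by (simp add: truncated_reciprocal_def)

lemma truncated_reciprocal_le_divide: "k > 0 \<Longrightarrow> truncated_reciprocal T y k \<le> y / real k"
  by (simp add: truncated_reciprocal_def)

lemma antimono_truncated_reciprocal:
  assumes "0 \<le> y"
  shows "antimono (truncated_reciprocal T y)"
proof (rule antimonoI)
  fix j k :: nat assume "j \<le> k"
  then have "y / real k \<le> y / real j" if "j > 0"
    using assms that by (intro divide_left_mono) auto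
  with \<open>j \<le> k\<close> show "truncated_reciprocal T y k \<le> truncated_reciprocal T y j"
    by (auto simp: truncated_reciprocal_def min_le_iff_disj)
qed

lemma cong_cmod: "[x = x cmod l] (mod l)"
  by (simp add: cong_iff_dvd_diff minus_cmod_eq_mult_cdiv)

lemma norm_sum_additive_char_le:
  assumes "q > 0"
  shows "norm (\<Sum>b=1..n. additive_char q (x * int b))
           \<le> truncated_reciprocal (real n) (real q) (nat \<bar>x cmod int q\<bar>)"
proof -
  define u where "u = x cmod int q"
  have u_le: "2 * \<bar>u\<bar> \<le> int q" and u_cong: "[x = u] (mod int q)"
    using abs_cmod_less_equal[of "int q" x] assms by (simp_all add: u_def cong_cmod)
  let ?z = "additive_char q u"
  have "(\<Sum>b=1..n. additive_char q (x * int b)) = (\<Sum>b=1..n. ?z ^ b)"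
    using additive_char_cong[OF u_cong assms] by (simp add: additive_char_mult_of_nat)
  moreover have "norm (\<Sum>b=1..n. ?z ^ b) \<le> real n"
    using sum_norm_le[of "{1..n}" "\<lambda>b. ?z ^ b" "\<lambda>_. 1"] by (simp add: norm_power)
  moreover have "norm (\<Sum>b=1..n. ?z ^ b) \<le> real q / real_of_int \<bar>u\<bar>" if "u \<noteq> 0"
  proof -
    have pos: "0 < 4 * real_of_int \<bar>u\<bar> / real q"
      using that assms by simp
    have lower: "norm (?z - 1) \<ge> 4 * real_of_int \<bar>u\<bar> / real q"
      using assms u_le by (rule norm_additive_char_minus_1_ge)
    with pos have "?z \<noteq> 1" by auto
    have "norm (\<Sum>b=1..n. ?z ^ b) \<le> norm (?z - ?z ^ Suc n) / norm (?z - 1)"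
      using \<open>?z \<noteq> 1\<close> by (simp add: sum_gp norm_divide norm_minus_commute)
    also have "\<dots> \<le> 2 / (4 * real_of_int \<bar>u\<bar> / real q)"
      using norm_triangle_ineq4[of ?z "?z ^ Suc n"] lower pos
      by (intro frac_le) (simp_all add: norm_mult norm_power)
    also have "\<dots> \<le> real q / real_of_int \<bar>u\<bar>"
      using that by (simp add: divide_simps)
    finally show ?thesis .
  qed
  ultimately show ?thesis
    by (auto simp: truncated_reciprocal_def simp flip: u_def)
qed

section \<open>Counting solutions of congruences\<close>

lemma dvd_mult_iff_div_gcd_dvd:
  fixes q a h :: "'a :: semiring_gcd"
  assumes "q \<noteq> 0"
  shows "q dvd a * h \<longleftrightarrow> q div gcd q h dvd a"
proof -
  have "q dvd a * h \<longleftrightarrow> gcd q h * (q div gcd q h) dvd gcd q h * (a * (h div gcd q h))"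
    by (simp add: mult.left_commute)
  also have "\<dots> \<longleftrightarrow> q div gcd q h dvd a * (h div gcd q h)"
    using assms by (intro dvd_times_left_cancel_iff) simp
  also have "\<dots> \<longleftrightarrow> q div gcd q h dvd a"
    using assms by (intro coprime_dvd_mult_left_iff div_gcd_coprime) simp
  finally show ?thesis .
qed

lemma card_multiples_atMost:
  fixes d m :: nat
  assumes "d > 0"
  shows "card {a\<in>{1..m}. d dvd a} = m div d"
proof -
  have "bij_betw ((*) d) {1..m div d} {a\<in>{1..m}. d dvd a}"
    using assms
    by (intro bij_betwI[of _ _ _ "\<lambda>a. a div d"])
       (auto simp: div_le_mono less_eq_div_iff_mult_less_eq mult.commute div_greater_zero_iff dvd_imp_le
          Suc_le_eq)
  then show ?thesis
    by (simp add: bij_betw_same_card[symmetric])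
qed

lemma sum_gcd_le:
  assumes "q > 0"
  shows "(\<Sum>a=1..m. gcd a q) \<le> m * divisor_count q"
proof -
  have "(\<Sum>a=1..m. gcd a q) \<le> (\<Sum>a=1..m. \<Sum>d | d dvd q. if d dvd a then d else 0)"
  proof (rule sum_mono)
    fix a
    have "gcd a q = (\<Sum>d\<in>{gcd a q}. if d dvd a then d else 0)" by simp
    also have "\<dots> \<le> (\<Sum>d | d dvd q. if d dvd a then d else 0)"
      using assms by (intro sum_mono2) auto
    finally show "gcd a q \<le> (\<Sum>d | d dvd q. if d dvd a then d else 0)" .
  qed
  also have "\<dots> = (\<Sum>d | d dvd q. \<Sum>a=1..m. if d dvd a then d else 0)"
    by (rule sum.swap)
  also have "\<dots> = (\<Sum>d | d dvd q. card {a\<in>{1..m}. d dvd a} * d)"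
    by (simp flip: sum.inter_filter)
  also have "\<dots> \<le> (\<Sum>d | d dvd q. m)"
  proof (rule sum_mono)
    fix d assume "d \<in> {d. d dvd q}"
    then have "d > 0"
      using assms by (auto intro: dvd_pos_nat)
    then show "card {a\<in>{1..m}. d dvd a} * d \<le> m"
      by (simp only: card_multiples_atMost div_times_less_eq_dividend)
  qed
  finally show ?thesis
    by (simp add: divisor_count_def mult.commute)
qed

lemma inj_on_div_residue_class:
  fixes q :: nat
  assumes "\<And>v w. v \<in> V \<Longrightarrow> w \<in> V \<Longrightarrow> [v = w] (mod q)"
  shows "inj_on (\<lambda>v. v div q) V"
proof (rule inj_onI)
  fix v w assume "v \<in> V" "w \<in> V" and "v div q = w div q"
  moreover have "v mod q = w mod q"
    using assms[OF \<open>v \<in> V\<close> \<open>w \<in> V\<close>] by (simp only: cong_def)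
  ultimately show "v = w"
    by (metis div_mult_mod_eq)
qed

lemma card_linear_cong_le:
  assumes "q > 0"
  shows "card {h. h < q \<and> [int a * int h = u] (mod int q)} \<le> gcd a q"
proof -
  let ?H = "{h. h < q \<and> [int a * int h = u] (mod int q)}"
  define e where "e = q div gcd a q"
  have q_eq: "q = gcd a q * e"
    by (simp add: e_def)
  have "inj_on (\<lambda>h. h div e) ?H"
  proof (rule inj_on_div_residue_class)
    fix h h' assume "h \<in> ?H" "h' \<in> ?H"
    then have "[int a * int h = int a * int h'] (mod int q)"
      using cong_trans cong_sym by blast
    then have "int q dvd (int h - int h') * int a"
      by (simp add: cong_iff_dvd_diff algebra_simps)
    then have "int e dvd int h - int h'"
      using assms by (simp add: dvd_mult_iff_div_gcd_dvd e_def zdiv_int gcd.commute)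
    then show "[h = h'] (mod e)"
      by (simp add: cong_iff_dvd_diff flip: cong_int_iff)
  qed
  moreover have "(\<lambda>h. h div e) ` ?H \<subseteq> {..<gcd a q}"
    using q_eq by (auto simp: less_mult_imp_div_less)
  ultimately have "card ?H \<le> card {..<gcd a q}"
    by (intro card_inj_on_le) auto
  then show ?thesis by simp
qed

lemma sum_nat_residue_class_antimono_le:
  fixes f :: "nat \<Rightarrow> real"
  assumes "antimono f" "\<And>k. 0 \<le> f k"
  shows "(\<Sum>v | v \<le> X \<and> [int v = c] (mod int q). f v) \<le> (\<Sum>j\<le>X div q. f (j * q))"
proof -
  let ?V = "{v. v \<le> X \<and> [int v = c] (mod int q)}"
  have inj: "inj_on (\<lambda>v. v div q) ?V"
    by (intro inj_on_div_residue_class) (auto simp flip: cong_int_iff intro: cong_trans cong_sym)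
  have "(\<Sum>v\<in>?V. f v) \<le> (\<Sum>v\<in>?V. f (v div q * q))"
    by (intro sum_mono antimonoD[OF assms(1)]) simp
  also have "\<dots> = (\<Sum>j\<in>(\<lambda>v. v div q) ` ?V. f (j * q))"
    by (simp add: sum.reindex[OF inj])
  also have "\<dots> \<le> (\<Sum>j\<le>X div q. f (j * q))"
    using assms(2) by (intro sum_mono2) (auto simp: div_le_mono)
  finally show ?thesis .
qed

lemma sum_nat_abs_le:
  fixes f :: "nat \<Rightarrow> real"
  assumes "finite V" "\<And>k. 0 \<le> f k"
  shows "(\<Sum>v\<in>V. f (nat \<bar>v\<bar>)) \<le> (\<Sum>k | int k \<in> V. f k) + (\<Sum>k | - int k \<in> V. f k)"
proof -
  define P N where "P = {k. int k \<in> V}" and "N = {k. - int k \<in> V}"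
  have V_eq: "V = int ` P \<union> (\<lambda>k. - int k) ` N"
    by (auto simp: P_def N_def image_iff) (metis int_cases2)
  have "finite (int ` P)" "finite ((\<lambda>k. - int k) ` N)"
    using assms(1) by (auto simp: P_def N_def intro: finite_subset[of _ V])
  then have "(\<Sum>v\<in>V. f (nat \<bar>v\<bar>)) \<le>
      (\<Sum>v\<in>int ` P. f (nat \<bar>v\<bar>)) + (\<Sum>v\<in>(\<lambda>k. - int k) ` N. f (nat \<bar>v\<bar>))"
    unfolding V_eq using assms(2) by (simp add: sum_Un sum_nonneg)
  also have "\<dots> = (\<Sum>k\<in>P. f k) + (\<Sum>k\<in>N. f k)"
    by (subst (1 2) sum.reindex) (auto simp: inj_on_def)
  finally show ?thesis
    by (simp add: P_def N_def)
qed

lemma sum_int_residue_class_antimono_le: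
  fixes f :: "nat \<Rightarrow> real"
  assumes "antimono f" "\<And>k. 0 \<le> f k"
  shows "(\<Sum>v | \<bar>v\<bar> \<le> int X \<and> [v = c] (mod int q). f (nat \<bar>v\<bar>)) \<le> 2 * (\<Sum>j\<le>X div q. f (j * q))"
proof -
  let ?V = "{v. \<bar>v\<bar> \<le> int X \<and> [v = c] (mod int q)}"
  have "finite ?V"
    by (rule finite_subset[of _ "{- int X..int X}"]) auto
  then have "(\<Sum>v\<in>?V. f (nat \<bar>v\<bar>)) \<le> (\<Sum>k | int k \<in> ?V. f k) + (\<Sum>k | - int k \<in> ?V. f k)"
    using assms(2) by (rule sum_nat_abs_le)
  also have "{k. - int k \<in> ?V} = {k. k \<le> X \<and> [int k = - c] (mod int q)}"
    using cong_minus_minus_iff[of _ "- c" "int q"] by auto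
  also have "{k. int k \<in> ?V} = {k. k \<le> X \<and> [int k = c] (mod int q)}"
    by auto
  finally show ?thesis
    using sum_nat_residue_class_antimono_le[OF assms, of X c q]
      sum_nat_residue_class_antimono_le[OF assms, of X "- c" q] by simp
qed

lemma sum_truncated_reciprocal_multiples_le:
  assumes "q > 0" "y \<ge> 0"
  shows "(\<Sum>j\<le>J. truncated_reciprocal T y (j * q)) \<le> T + y / real q * harm J"
proof -
  have "(\<Sum>j\<le>J. truncated_reciprocal T y (j * q)) = T + (\<Sum>j=1..J. truncated_reciprocal T y (j * q))"
    by (simp add: sum.atMost_shift truncated_reciprocal_def sum.atLeast1_atMost_eq lessThan_Suc_atMost)
  also have "\<dots> \<le> T + (\<Sum>j=1..J. y / real q * inverse (real j))"
    using assms by (intro add_left_mono sum_mono order.trans[OF truncated_reciprocal_le_divide])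
      (auto simp: field_simps)
  finally show ?thesis
    by (simp add: harm_def sum_distrib_left)
qed

lemma sum_truncated_reciprocal_symmetric_le:
  assumes "T \<ge> 0" "y \<ge> 0"
  shows "(\<Sum>u | u \<noteq> 0 \<and> \<bar>u\<bar> \<le> int q. truncated_reciprocal T y (nat \<bar>u\<bar>)) \<le> 2 * y * harm q"
proof -
  let ?I = "{u. u \<noteq> 0 \<and> \<bar>u\<bar> \<le> int q}"
  have "finite ?I"
    by (rule finite_subset[of _ "{- int q..int q}"]) auto
  then have "(\<Sum>u\<in>?I. truncated_reciprocal T y (nat \<bar>u\<bar>)) \<le>
      (\<Sum>k | int k \<in> ?I. truncated_reciprocal T y k) + (\<Sum>k | - int k \<in> ?I. truncated_reciprocal T y k)"
    using assms by (intro sum_nat_abs_le truncated_reciprocal_nonneg)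
  also have "\<dots> = 2 * (\<Sum>k=1..q. truncated_reciprocal T y k)"
  proof -
    have "{k. int k \<in> ?I} = {1..q}" "{k. - int k \<in> ?I} = {1..q}"
      by auto
    then show ?thesis
      by (simp only: mult_2)
  qed
  also have "(\<Sum>k=1..q. truncated_reciprocal T y k) \<le> (\<Sum>k=1..q. y * inverse (real k))"
    by (intro sum_mono) (simp add: truncated_reciprocal_le_divide flip: divide_inverse)
  finally show ?thesis
    by (simp add: harm_def sum_distrib_left mult.assoc)
qed

lemma card_factorizations_le:
  assumes "v \<noteq> 0" "\<And>a u. (a, u) \<in> F \<Longrightarrow> int a * u = v"
  shows "card F \<le> divisor_count (nat \<bar>v\<bar>)"
  unfolding divisor_count_def
proof (rule card_inj_on_le)
  show "inj_on fst F"
    by (rule inj_onI) (metis assms mult_cancel_left mult_zero_left prod.collapse)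
  show "fst ` F \<subseteq> {d. d dvd nat \<bar>v\<bar>}"
  proof clarify
    fix a u assume "(a, u) \<in> F"
    then have "int a dvd v"
      using assms(2) by (metis dvd_triv_left)
    then show "fst (a, u) dvd nat \<bar>v\<bar>"
      by simp
  qed
  show "finite {d. d dvd nat \<bar>v\<bar>}"
    using assms(1) by (intro finite_divisors_nat) simp
qed

definition small_product_cong_solutions :: "nat \<Rightarrow> nat \<Rightarrow> int \<Rightarrow> (nat \<times> int) set" where
  "small_product_cong_solutions q m c =
     {(a, u). a \<in> {1..m} \<and> u \<noteq> 0 \<and> \<bar>u\<bar> \<le> int q \<and> [int a * u = c] (mod int q)}"

lemma finite_small_product_cong_solutions: "finite (small_product_cong_solutions q m c)"
  by (rule finite_subset[of _ "{1..m} \<times> {- int q..int q}"]) (auto simp: small_product_cong_solutions_def)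

lemma sum_small_product_cong_solutions_product_le:
  fixes D :: real and g :: "int \<Rightarrow> real"
  assumes g_nonneg: "\<And>v. 0 \<le> g v"
    and D_bound: "\<And>v. 0 < v \<Longrightarrow> v \<le> m * q \<Longrightarrow> real (divisor_count v) \<le> D" and "D \<ge> 0"
  shows "(\<Sum>(a, u)\<in>small_product_cong_solutions q m c. g (int a * u))
           \<le> D * (\<Sum>v | \<bar>v\<bar> \<le> int (m * q) \<and> [v = c] (mod int q). g v)"
proof -
  let ?S = "small_product_cong_solutions q m c"
  let ?V = "{v. \<bar>v\<bar> \<le> int (m * q) \<and> [v = c] (mod int q)}"
  let ?fibre = "\<lambda>v. {p \<in> ?S. (case p of (a, u) \<Rightarrow> int a * u) = v}"
  have fin: "finite ?V"
    by (rule finite_subset[of _ "{- int (m * q)..int (m * q)}"]) auto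
  have products: "(\<lambda>(a, u). int a * u) ` ?S \<subseteq> ?V"
  proof (clarsimp simp: small_product_cong_solutions_def)
    fix a :: nat and u :: int assume "a \<le> m" "\<bar>u\<bar> \<le> int q"
    then show "\<bar>int a * u\<bar> \<le> int m * int q"
      unfolding abs_mult by (intro mult_mono) auto
  qed
  have card_fibre: "real (card (?fibre v)) \<le> D" if v_mem: "v \<in> ?V" for v
  proof (cases "v = 0")
    case True
    then have "?fibre v = {}"
      by (auto simp: small_product_cong_solutions_def)
    then have "card (?fibre v) = 0"
      by (simp only: card.empty)
    then show ?thesis
      using \<open>D \<ge> 0\<close> by simp
  next
    case False
    then have "card (?fibre v) \<le> divisor_count (nat \<bar>v\<bar>)"
      by (intro card_factorizations_le) auto
    then show ?thesis
      using D_bound[of "nat \<bar>v\<bar>"] False v_mem by (simp add: nat_le_iff)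
  qed
  have "(\<Sum>(a, u)\<in>?S. g (int a * u)) = (\<Sum>p\<in>?S. g (case p of (a, u) \<Rightarrow> int a * u))"
    by (simp add: case_prod_unfold)
  also have "\<dots> = (\<Sum>v\<in>?V. \<Sum>p\<in>?fibre v. g v)"
    by (subst sum.group[OF finite_small_product_cong_solutions fin products, symmetric]) simp
  also have "\<dots> \<le> (\<Sum>v\<in>?V. D * g v)"
    using card_fibre g_nonneg by (intro sum_mono) (simp add: mult_right_mono)
  finally show ?thesis
    by (simp add: sum_distrib_left)
qed

lemma sum_small_product_cong_solutions_le:
  fixes D T :: real
  assumes "q > 0" "T \<ge> 0"
    and D_bound: "\<And>v. 0 < v \<Longrightarrow> v \<le> m * q \<Longrightarrow> real (divisor_count v) \<le> D" and "D \<ge> 0"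
  shows "(\<Sum>(a, u)\<in>small_product_cong_solutions q m c. truncated_reciprocal T (real q) (nat \<bar>u\<bar>))
           \<le> 2 * D * (T + real m * harm m)"
proof -
  let ?S = "small_product_cong_solutions q m c"
  let ?f = "truncated_reciprocal T (real (m * q))"
  have "(\<Sum>(a, u)\<in>?S. truncated_reciprocal T (real q) (nat \<bar>u\<bar>)) \<le> (\<Sum>(a, u)\<in>?S. ?f (nat \<bar>int a * u\<bar>))"
  proof (intro sum_mono, clarify)
    fix a u assume "(a, u) \<in> ?S"
    then have au_bounds: "1 \<le> a" "a \<le> m" "u \<noteq> 0"
      by (auto simp: small_product_cong_solutions_def)
    then have "real q / \<bar>real_of_int u\<bar> \<le> real (m * q) / (real a * \<bar>real_of_int u\<bar>)"
      by (simp add: divide_simps mult.commute[of "real m"] mult_left_mono)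
    then show "truncated_reciprocal T (real q) (nat \<bar>u\<bar>) \<le> ?f (nat \<bar>int a * u\<bar>)"
      using au_bounds by (auto simp: truncated_reciprocal_def abs_mult)
  qed
  also have "\<dots> \<le> D * (\<Sum>v | \<bar>v\<bar> \<le> int (m * q) \<and> [v = c] (mod int q). ?f (nat \<bar>v\<bar>))"
    using D_bound \<open>D \<ge> 0\<close> assms(2)
    by (intro sum_small_product_cong_solutions_product_le[where g = "\<lambda>v. ?f (nat \<bar>v\<bar>)"]
        truncated_reciprocal_nonneg) auto
  also have "\<dots> \<le> D * (2 * (T + real (m * q) / real q * harm (m * q div q)))"
    using assms
    by (intro mult_left_mono order.trans[OF sum_int_residue_class_antimono_le] antimono_truncated_reciprocal
        truncated_reciprocal_nonneg sum_truncated_reciprocal_multiples_le) auto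
  finally show ?thesis
    using assms(1) by (simp add: mult_ac)
qed

section \<open>Second moment of incomplete character sums\<close>

lemma cmod_nonzero_and_abs_le:
  assumes "q > 0" "\<not> q dvd x"
  shows "int x cmod int q \<noteq> 0" "\<bar>int x cmod int q\<bar> \<le> int q"
proof -
  show "int x cmod int q \<noteq> 0"
    using assms(2) cdiv_mult_cmod_eq[of "int x" "int q"]
    by (metis add.right_neutral dvd_triv_right of_nat_dvd_iff)
  show "\<bar>int x cmod int q\<bar> \<le> int q"
    using abs_cmod_less_equal[of "int q" "int x"] assms(1) by simp
qed

lemma cmod_mem_small_product_cong_solutions:
  assumes "q > 0" "a' \<in> {1..m}" "\<not> q dvd a * h"
  shows "(a', int (a * h) cmod int q)
           \<in> small_product_cong_solutions q m (int a * (int (a' * h) cmod int q))"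
proof -
  have "[int a' * (int (a * h) cmod int q) = int a' * int (a * h)] (mod int q)"
    by (intro cong_mult cong_refl cong_sym[OF cong_cmod])
  also have "int a' * int (a * h) = int a * int (a' * h)"
    by simp
  also have "[int a * int (a' * h) = int a * (int (a' * h) cmod int q)] (mod int q)"
    by (intro cong_mult cong_refl cong_cmod)
  finally show ?thesis
    using assms(2) cmod_nonzero_and_abs_le[OF assms(1,3)]
    by (simp only: small_product_cong_solutions_def mem_Collect_eq case_prod_conv) simp
qed

text \<open>
  With \<open>u \<equiv> a h\<close> and \<open>u' \<equiv> a' h\<close> one has \<open>a' u \<equiv> a u'\<close>. Hence the pairs \<open>(h, a')\<close> are enumerated by
  choosing \<open>u'\<close> first, then \<open>(a', u)\<close> among the solutions of this congruence, and \<open>h\<close> last.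
\<close>

lemma sum_weighted_residue_pairs_le:
  fixes w :: "int \<Rightarrow> real"
  assumes "q > 0" and w_nonneg: "\<And>u. 0 \<le> w u"
  shows "(\<Sum>h | h < q \<and> \<not> q dvd a * h. \<Sum>a' | a' \<in> {1..m} \<and> \<not> q dvd a' * h.
             w (int (a * h) cmod int q) * w (int (a' * h) cmod int q))
           \<le> real (gcd a q) * (\<Sum>u' | u' \<noteq> 0 \<and> \<bar>u'\<bar> \<le> int q. w u' *
                (\<Sum>(a', u)\<in>small_product_cong_solutions q m (int a * u'). w u))"
proof -
  let ?\<rho> = "\<lambda>a h. int (a * h) cmod int q"
  let ?S = "\<lambda>u'. small_product_cong_solutions q m (int a * u')"
  let ?I = "{u. u \<noteq> 0 \<and> \<bar>u\<bar> \<le> int q}"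
  define H where "H u = {h. h < q \<and> [int a * int h = u] (mod int q)}" for u
  have "finite ?I"
    by (rule finite_subset[of _ "{- int q..int q}"]) auto
  have H_card: "finite (H u)" "card (H u) \<le> gcd a q" for u
    unfolding H_def using card_linear_cong_le[OF assms(1)] by auto
  let ?L = "SIGMA h:{h. h < q \<and> \<not> q dvd a * h}. {a'. a' \<in> {1..m} \<and> \<not> q dvd a' * h}"
  let ?R = "SIGMA u':?I. SIGMA p:?S u'. H (snd p)"
  let ?project = "\<lambda>(u', (a', u), h). (h, a')"
  let ?f = "\<lambda>(h, a'). w (?\<rho> a h) * w (?\<rho> a' h)" and ?g = "\<lambda>(u', (a', u), h). w u' * w u"
  have "sum ?f ?L \<le> sum ?g ?R"
  proof (rule sum_le_included[where i = ?project])
    show "\<forall>x\<in>?L. \<exists>y\<in>?R. ?project y = x \<and> ?f x \<le> ?g y"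
    proof
      fix x assume "x \<in> ?L"
      then obtain h a' where x_eq: "x = (h, a')"
        and h_not_dvd: "h < q" "\<not> q dvd a * h" and a'_not_dvd: "a' \<in> {1..m}" "\<not> q dvd a' * h"
        by auto
      have "?\<rho> a' h \<in> ?I"
        using cmod_nonzero_and_abs_le[OF assms(1) a'_not_dvd(2)] by simp
      moreover have "h \<in> H (?\<rho> a h)"
        using h_not_dvd(1) cong_cmod[of "int (a * h)" "int q"] by (simp add: H_def)
      ultimately have "(?\<rho> a' h, (a', ?\<rho> a h), h) \<in> ?R"
        using cmod_mem_small_product_cong_solutions[OF assms(1) a'_not_dvd(1) h_not_dvd(2)] by simp
      then show "\<exists>y\<in>?R. ?project y = x \<and> ?f x \<le> ?g y"
        unfolding x_eq by (intro bexI[of _ "(?\<rho> a' h, (a', ?\<rho> a h), h)"]) (simp_all add: mult.commute)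
    qed
  qed (use w_nonneg H_card \<open>finite ?I\<close> finite_small_product_cong_solutions in \<open>auto intro!: finite_SigmaI\<close>)
  also have "\<dots> = (\<Sum>u'\<in>?I. \<Sum>p\<in>?S u'. \<Sum>h\<in>H (snd p). w u' * w (snd p))"
    using H_card \<open>finite ?I\<close> finite_small_product_cong_solutions
    by (simp add: sum.Sigma finite_SigmaI case_prod_unfold del: sum_constant)
  also have "\<dots> \<le> (\<Sum>u'\<in>?I. \<Sum>(a', u)\<in>?S u'. real (gcd a q) * (w u' * w u))"
    using H_card w_nonneg by (intro sum_mono) (auto intro!: sum_mono mult_right_mono)
  also have "\<dots> = real (gcd a q) * (\<Sum>u'\<in>?I. w u' * (\<Sum>(a', u)\<in>?S u'. w u))"
    by (simp add: sum_distrib_left case_prod_unfold)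
  finally show ?thesis
    by (simp add: sum.Sigma)
qed

lemma sum_truncated_reciprocal_residue_pairs_le:
  fixes D T :: real
  assumes "q > 0" "T \<ge> 0"
    and D_bound: "\<And>v. 0 < v \<Longrightarrow> v \<le> m * q \<Longrightarrow> real (divisor_count v) \<le> D" and "D \<ge> 0"
  defines "w \<equiv> \<lambda>x. truncated_reciprocal T (real q) (nat \<bar>x cmod int q\<bar>)"
  shows "(\<Sum>h | h < q \<and> \<not> q dvd a * h. \<Sum>a' | a' \<in> {1..m} \<and> \<not> q dvd a' * h.
             w (int (a * h)) * w (int (a' * h)))
           \<le> real (gcd a q) * (4 * real q * harm q * D * (T + real m * harm m))"
proof -
  let ?w = "\<lambda>u. truncated_reciprocal T (real q) (nat \<bar>u\<bar>)"
  have "(\<Sum>h | h < q \<and> \<not> q dvd a * h. \<Sum>a' | a' \<in> {1..m} \<and> \<not> q dvd a' * h.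
      w (int (a * h)) * w (int (a' * h))) \<le>
      real (gcd a q) * (\<Sum>u' | u' \<noteq> 0 \<and> \<bar>u'\<bar> \<le> int q. ?w u' *
        (\<Sum>(a', u)\<in>small_product_cong_solutions q m (int a * u'). ?w u))"
    unfolding w_def using assms(1,2)
    by (intro sum_weighted_residue_pairs_le[where w = ?w] truncated_reciprocal_nonneg) auto
  also have "\<dots> \<le> real (gcd a q) *
      (\<Sum>u' | u' \<noteq> 0 \<and> \<bar>u'\<bar> \<le> int q. ?w u' * (2 * D * (T + real m * harm m)))"
    using assms
    by (intro mult_left_mono sum_mono sum_small_product_cong_solutions_le truncated_reciprocal_nonneg) auto
  also have "\<dots> \<le> real (gcd a q) * (2 * real q * harm q * (2 * D * (T + real m * harm m)))"
    unfolding sum_distrib_right[symmetric] using assms(2) \<open>D \<ge> 0\<close>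
    by (intro mult_left_mono mult_right_mono sum_truncated_reciprocal_symmetric_le)
      (auto simp: harm_nonneg)
  finally show ?thesis
    by (simp add: mult_ac)
qed

theorem second_moment_incomplete_sums_le:
  fixes D :: real
  assumes "q > 0"
    and D_bound: "\<And>v. 0 < v \<Longrightarrow> v \<le> m * q \<Longrightarrow> real (divisor_count v) \<le> D" and "D \<ge> 0"
  shows "(\<Sum>h<q. (\<Sum>a | a \<in> {1..m} \<and> \<not> q dvd a * h.
             norm (\<Sum>b=1..n. additive_char q (int (a * h) * int b)))\<^sup>2)
           \<le> 4 * real m * real (divisor_count q) * real q * harm q * D * (real n + real m * harm m)"
proof -
  let ?w = "\<lambda>x. truncated_reciprocal (real n) (real q) (nat \<bar>x cmod int q\<bar>)"
  let ?A = "\<lambda>h. {a. a \<in> {1..m} \<and> \<not> q dvd a * h}"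
  let ?B = "4 * real q * harm q * D * (real n + real m * harm m)"
  let ?F = "\<lambda>h a. \<Sum>a'\<in>?A h. ?w (int (a * h)) * ?w (int (a' * h))"
  have "?B \<ge> 0"
    using \<open>D \<ge> 0\<close> by (simp add: harm_nonneg)
  have "(\<Sum>h<q. (\<Sum>a\<in>?A h. norm (\<Sum>b=1..n. additive_char q (int (a * h) * int b)))\<^sup>2)
      \<le> (\<Sum>h<q. (\<Sum>a\<in>?A h. ?w (int (a * h)))\<^sup>2)"
    using assms(1) by (intro sum_mono power_mono norm_sum_additive_char_le sum_nonneg) auto
  also have "\<dots> = (\<Sum>h<q. \<Sum>a\<in>?A h. ?F h a)"
    by (simp add: power2_eq_square sum_product)
  also have "\<dots> = (\<Sum>a=1..m. \<Sum>h | h < q \<and> \<not> q dvd a * h. ?F h a)"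
    using sum.swap_restrict[of "{..<q}" "{1..m}" ?F "\<lambda>h a. \<not> q dvd a * h"]
    by (simp only: lessThan_iff finite_lessThan finite_atLeastAtMost)
  also have "\<dots> \<le> (\<Sum>a=1..m. real (gcd a q) * ?B)"
    using assms by (intro sum_mono sum_truncated_reciprocal_residue_pairs_le) auto
  also have "\<dots> = real (\<Sum>a=1..m. gcd a q) * ?B"
    by (simp add: sum_distrib_right)
  also have "\<dots> \<le> real (m * divisor_count q) * ?B"
    using sum_gcd_le[OF assms(1)] \<open>?B \<ge> 0\<close> by (intro mult_right_mono of_nat_mono)
  finally show ?thesis
    by (simp add: mult_ac)
qed

section \<open>Variance over residue classes\<close>

lemma restricted_divisor_count_eq:
  "restricted_divisor_count M N k =
     card {p\<in>{1..nat \<lfloor>M\<rfloor>} \<times> {1..nat \<lfloor>N\<rfloor>}. fst p * snd p = k}"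
proof -
  have iff: "0 < a \<and> real a \<le> x \<longleftrightarrow> a \<in> {1..nat \<lfloor>x\<rfloor>}" for a :: nat and x
    by (auto simp: le_nat_floor) linarith
  have "{(a :: nat, b :: nat). 0 < a \<and> 0 < b \<and> real a \<le> M \<and> real b \<le> N \<and> a * b = k} =
        {p\<in>{1..nat \<lfloor>M\<rfloor>} \<times> {1..nat \<lfloor>N\<rfloor>}. fst p * snd p = k}"
    using iff[of _ M] iff[of _ N] unfolding set_eq_iff mem_Collect_eq mem_Times_iff by fastforce
  then show ?thesis by (simp add: restricted_divisor_count_def)
qed

lemma divisor_progression_sum_eq_card:
  "divisor_progression_sum M N q r =
     real (card {p\<in>{1..nat \<lfloor>M\<rfloor>} \<times> {1..nat \<lfloor>N\<rfloor>}. [fst p * snd p = r] (mod q)})"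
proof -
  let ?P = "{p\<in>{1..nat \<lfloor>M\<rfloor>} \<times> {1..nat \<lfloor>N\<rfloor>}. [fst p * snd p = r] (mod q)}"
  let ?K = "(\<lambda>p. fst p * snd p) ` ?P"
  have "divisor_progression_sum M N q r = (\<Sum>\<^sub>\<infinity>k\<in>?K. real (restricted_divisor_count M N k))"
    unfolding divisor_progression_sum_def
  proof (rule infsum_cong_neutral)
    fix k assume "k \<in> {k. 0 < k \<and> [k = r] (mod q)} - ?K"
    then have "{p\<in>{1..nat \<lfloor>M\<rfloor>} \<times> {1..nat \<lfloor>N\<rfloor>}. fst p * snd p = k} = {}" by force
    then show "real (restricted_divisor_count M N k) = 0"
      by (simp only: restricted_divisor_count_eq card.empty of_nat_0)
  qed auto
  also have "\<dots> = (\<Sum>k\<in>?K. real (restricted_divisor_count M N k))"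
    by (rule infsum_finite) auto
  also have "\<dots> = (\<Sum>k\<in>?K. real (card {p\<in>?P. fst p * snd p = k}))"
    unfolding restricted_divisor_count_eq
    by (intro sum.cong arg_cong[of _ _ real] arg_cong[of _ _ card]) auto
  also have "\<dots> = real (card ?P)"
    using sum.image_gen[of ?P "\<lambda>_. 1 :: real" "\<lambda>p. fst p * snd p"] by simp
  finally show ?thesis .
qed

lemma residue_fourier_divisor_progression_sum:
  assumes "q > 0"
  shows "residue_fourier q (\<lambda>r. of_real (divisor_progression_sum M N q r)) h =
           (\<Sum>a=1..nat \<lfloor>M\<rfloor>. \<Sum>b=1..nat \<lfloor>N\<rfloor>. additive_char q (int (a * h) * int b))"
  using residue_fourier_card_cong[OF assms, of "{1..nat \<lfloor>M\<rfloor>} \<times> {1..nat \<lfloor>N\<rfloor>}" "\<lambda>p. fst p * snd p" h]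
  by (simp add: divisor_progression_sum_eq_card sum.cartesian_product case_prod_unfold mult_ac)

lemma divisor_progression_main_eq_totient:
  assumes "q > 0" "k dvd q"
  shows "divisor_progression_main M N q k =
           M * N / (real q)\<^sup>2 * (\<Sum>d | d dvd k. real d * real (totient (q div d)))"
proof -
  have "real d * real (totient (q div d)) =
      (\<Sum>c | c dvd q div d. real d * real c * of_int (moebius_mu (q div (d * c))))" if "d dvd k" for d
  proof -
    have "q div d > 0"
      using that assms by (metis dvd_div_eq_0_iff dvd_trans gr0I less_not_refl)
    then show ?thesis
      by (simp add: totient_eq_sum_moebius_mu sum_distrib_left div_mult2_eq mult.assoc)
  qed
  then show ?thesis
    by (simp add: divisor_progression_main_def)
qed

lemma sum_totient_complementary_divisors:
  assumes "q > 0"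
  shows "(\<Sum>d | d dvd q. if q div d dvd h then totient (q div d) else 0) = gcd h q"
proof -
  have "(\<Sum>d | d dvd q. if q div d dvd h then totient (q div d) else 0) =
      (\<Sum>e | e dvd q. if e dvd h then totient e else 0)"
    using assms by (intro sum.reindex_bij_witness[of _ "\<lambda>e. q div e" "\<lambda>e. q div e"]) (auto elim!: dvdE)
  also have "\<dots> = (\<Sum>e | e dvd gcd h q. totient e)"
    using assms by (intro sum.mono_neutral_cong_right) auto
  also have "\<dots> = gcd h q"
    by (rule totient_divisor_sum)
  finally show ?thesis .
qed

lemma residue_fourier_divisor_progression_main:
  assumes "q > 0"
  shows "residue_fourier q (\<lambda>r. of_real (divisor_progression_main M N q (gcd r q))) h =
           of_real (M * N * real (gcd h q) / real q)"
proof -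
  define K where "K = M * N / (real q)\<^sup>2"
  have "divisor_progression_main M N q (gcd r q) =
      (\<Sum>d | d dvd q. K * real d * real (totient (q div d)) * of_bool (d dvd r))" for r
  proof -
    have "(\<Sum>d | d dvd gcd r q. real d * real (totient (q div d))) =
        (\<Sum>d | d dvd q. real d * real (totient (q div d)) * of_bool (d dvd r))"
      using assms by (intro sum.mono_neutral_cong_left) auto
    then show ?thesis
      by (simp add: divisor_progression_main_eq_totient[OF assms] K_def sum_distrib_left mult.assoc)
  qed
  then have "residue_fourier q (\<lambda>r. of_real (divisor_progression_main M N q (gcd r q))) h =
      (\<Sum>d | d dvd q. of_real (K * real d * real (totient (q div d))) *
         residue_fourier q (\<lambda>r. of_bool (d dvd r)) h)"
    by (simp add: of_bool_def if_distrib[of complex_of_real] cong: if_cong flip: residue_fourier_sum)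
  also have "\<dots> = (\<Sum>d | d dvd q. of_real (K * real q * real (if q div d dvd h then totient (q div d) else 0)))"
  proof (intro sum.cong refl)
    fix d assume "d \<in> {d. d dvd q}"
    then have d_dvd: "d dvd q" by simp
    then have "real q = real d * real (q div d)"
      by (simp flip: of_nat_mult)
    then show "of_real (K * real d * real (totient (q div d))) * residue_fourier q (\<lambda>r. of_bool (d dvd r)) h =
        complex_of_real (K * real q * real (if q div d dvd h then totient (q div d) else 0))"
      by (simp add: residue_fourier_multiples[OF assms d_dvd])
  qed
  also have "\<dots> = of_real (K * real q * real (\<Sum>d | d dvd q. if q div d dvd h then totient (q div d) else 0))"
    by (simp add: sum_distrib_left)
  finally show ?thesis
    using assms by (simp add: sum_totient_complementary_divisors K_def power2_eq_square)
qed

lemma abs_floor_mult_floor_minus_mult_le: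
  fixes x y :: real
  assumes "0 \<le> x" "0 \<le> y"
  shows "\<bar>real_of_int \<lfloor>x\<rfloor> * real_of_int \<lfloor>y\<rfloor> - x * y\<bar> \<le> x + y"
proof -
  have "x * y - real_of_int \<lfloor>x\<rfloor> * real_of_int \<lfloor>y\<rfloor> = x * frac y + real_of_int \<lfloor>y\<rfloor> * frac x"
    by (simp add: frac_def algebra_simps)
  moreover have "0 \<le> x * frac y" "0 \<le> real_of_int \<lfloor>y\<rfloor> * frac x"
    using assms by (auto intro!: mult_nonneg_nonneg)
  moreover have "x * frac y \<le> x * 1" "real_of_int \<lfloor>y\<rfloor> * frac x \<le> y * 1"
    using assms frac_lt_1[of x] frac_lt_1[of y] by (intro mult_mono; simp)+
  ultimately show ?thesis by linarith
qed

lemma abs_floor_div_mult_floor_minus_le: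
  fixes x y :: real
  assumes "0 \<le> x" "0 \<le> y" "e > 0"
  shows "\<bar>real (nat \<lfloor>x\<rfloor> div e) * real (nat \<lfloor>y\<rfloor>) - x / real e * y\<bar> \<le> x + y"
proof -
  have "int (nat \<lfloor>x\<rfloor> div e) = \<lfloor>x / real e\<rfloor>" "int (nat \<lfloor>y\<rfloor>) = \<lfloor>y\<rfloor>"
    using assms floor_divide_real_eq_div[of "int e" x] by (simp_all add: zdiv_int)
  then have "real (nat \<lfloor>x\<rfloor> div e) = real_of_int \<lfloor>x / real e\<rfloor>" "real (nat \<lfloor>y\<rfloor>) = real_of_int \<lfloor>y\<rfloor>"
    by (metis of_int_of_nat_eq)+
  then have "\<bar>real (nat \<lfloor>x\<rfloor> div e) * real (nat \<lfloor>y\<rfloor>) - x / real e * y\<bar> \<le> x / real e + y"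
    using abs_floor_mult_floor_minus_mult_le[of "x / real e" y] assms by simp
  also have "x / real e \<le> x"
    using assms by (simp add: divide_le_eq mult_le_cancel_left1)
  finally show ?thesis by simp
qed

lemma sum_additive_char_multiples:
  assumes "q > 0"
  shows "(\<Sum>a | a \<in> {1..m} \<and> q dvd a * h. \<Sum>b=1..n. additive_char q (int (a * h) * int b)) =
           of_nat (m div (q div gcd q h) * n)"
proof -
  have "0 < q div gcd q h"
    using assms by (simp add: div_greater_zero_iff)
  have "additive_char q (int (a * h) * int b) = 1" if "q dvd a * h" for a b
    using that assms by (simp only: additive_char_eq_1_iff of_nat_dvd_iff dvd_mult2 flip: of_nat_mult)
  then have "(\<Sum>a | a \<in> {1..m} \<and> q dvd a * h. \<Sum>b=1..n. additive_char q (int (a * h) * int b)) =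
      of_nat (card {a\<in>{1..m}. q div gcd q h dvd a} * n)"
    using assms by (simp add: dvd_mult_iff_div_gcd_dvd)
  then show ?thesis
    by (simp only: card_multiples_atMost[OF \<open>0 < q div gcd q h\<close>])
qed

lemma norm_residue_fourier_divisor_progression_le:
  assumes "q > 0" "M \<ge> 0" "N \<ge> 0"
  shows "norm (residue_fourier q (\<lambda>r. of_real (divisor_progression_sum M N q r) -
             of_real (divisor_progression_main M N q (gcd r q))) h)
           \<le> (M + N) + (\<Sum>a | a \<in> {1..nat \<lfloor>M\<rfloor>} \<and> \<not> q dvd a * h.
                norm (\<Sum>b=1..nat \<lfloor>N\<rfloor>. additive_char q (int (a * h) * int b)))"
proof -
  define m n where "m = nat \<lfloor>M\<rfloor>" and "n = nat \<lfloor>N\<rfloor>"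
  define e where "e = q div gcd q h"
  have "e > 0"
    using assms(1) by (simp add: e_def div_greater_zero_iff)
  let ?s = "\<lambda>a. \<Sum>b=1..n. additive_char q (int (a * h) * int b)"
  have floor_error: "\<bar>real (m div e) * real n - M / real e * N\<bar> \<le> M + N"
    unfolding m_def n_def using assms(2,3) \<open>e > 0\<close> by (rule abs_floor_div_mult_floor_minus_le)
  have main_term_eq: "M * N * real (gcd h q) / real q = M / real e * N"
    using assms(1) by (simp add: e_def real_of_nat_div gcd.commute[of h])
  have "residue_fourier q (\<lambda>r. of_real (divisor_progression_sum M N q r) -
          of_real (divisor_progression_main M N q (gcd r q))) h =
        (\<Sum>a=1..m. ?s a) - of_real (M / real e * N)"
    by (simp only: residue_fourier_diff residue_fourier_divisor_progression_sum[OF assms(1)]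
        residue_fourier_divisor_progression_main[OF assms(1)] main_term_eq m_def n_def)
  also have "\<dots> = of_real (real (m div e) * real n - M / real e * N) +
      (\<Sum>a | a \<in> {1..m} \<and> \<not> q dvd a * h. ?s a)"
  proof -
    have "(\<Sum>a=1..m. ?s a) =
        (\<Sum>a | a \<in> {1..m} \<and> q dvd a * h. ?s a) + (\<Sum>a | a \<in> {1..m} \<and> \<not> q dvd a * h. ?s a)"
      by (subst sum.union_disjoint[symmetric]) (auto intro!: sum.cong)
    then show ?thesis
      unfolding sum_additive_char_multiples[OF assms(1)] e_def[symmetric] by simp
  qed
  finally show ?thesis
    unfolding m_def[symmetric] n_def[symmetric] using floor_error
    by (auto intro!: order.trans[OF norm_triangle_ineq] add_mono norm_sum simp del: of_real_diff)
qed

definition divisor_progression_variance :: "real \<Rightarrow> real \<Rightarrow> nat \<Rightarrow> real" where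
  "divisor_progression_variance M N q =
     (\<Sum>r=1..q. (divisor_progression_sum M N q r - divisor_progression_main M N q (gcd r q))\<^sup>2)"

theorem divisor_progression_variance_le:
  fixes M N D :: real
  assumes "q > 0" "M \<ge> 0" "N \<ge> 0"
    and D_bound: "\<And>v. 0 < v \<Longrightarrow> v \<le> nat \<lfloor>M\<rfloor> * q \<Longrightarrow> real (divisor_count v) \<le> D" and "D \<ge> 0"
  shows "divisor_progression_variance M N q \<le>
           2 * (M + N)\<^sup>2 +
           8 * M * real (divisor_count q) * harm q * D * (N + M * harm (nat \<lfloor>M\<rfloor>))"
proof -
  define m n where "m = nat \<lfloor>M\<rfloor>" and "n = nat \<lfloor>N\<rfloor>"
  define f where "f r = divisor_progression_sum M N q r - divisor_progression_main M N q (gcd r q)" for r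
  define S where "S h = (\<Sum>a | a \<in> {1..m} \<and> \<not> q dvd a * h.
      norm (\<Sum>b=1..n. additive_char q (int (a * h) * int b)))" for h
  have floor_le: "real m \<le> M" "real n \<le> N"
    using assms by (auto simp: m_def n_def)
  have "divisor_progression_variance M N q = (\<Sum>r<q. (f r)\<^sup>2)"
  proof -
    have "f 0 = f q"
      by (simp add: f_def divisor_progression_sum_def cong_def)
    then show ?thesis
      unfolding divisor_progression_variance_def f_def[symmetric]
      using sum.lessThan_Suc_shift[of "\<lambda>r. (f r)\<^sup>2" q] by (simp add: sum.atLeast1_atMost_eq)
  qed
  also have "real q * \<dots> = (\<Sum>h<q. (norm (residue_fourier q (\<lambda>r. of_real (f r)) h))\<^sup>2)"
    using residue_fourier_parseval[OF assms(1), of "\<lambda>r. of_real (f r)"] by simp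
  also have "\<dots> \<le> (\<Sum>h<q. 2 * (M + N)\<^sup>2 + 2 * (S h)\<^sup>2)"
  proof (rule sum_mono)
    fix h
    have "(norm (residue_fourier q (\<lambda>r. of_real (f r)) h))\<^sup>2 \<le> ((M + N) + S h)\<^sup>2"
      using norm_residue_fourier_divisor_progression_le[OF assms(1-3), of h]
      by (intro power_mono) (simp_all add: f_def S_def m_def n_def)
    also have "\<dots> \<le> 2 * (M + N)\<^sup>2 + 2 * (S h)\<^sup>2"
      using sum_squares_bound[of "M + N" "S h"] by (simp add: power2_sum)
    finally show "(norm (residue_fourier q (\<lambda>r. of_real (f r)) h))\<^sup>2 \<le> 2 * (M + N)\<^sup>2 + 2 * (S h)\<^sup>2" .
  qed
  also have "\<dots> = real q * (2 * (M + N)\<^sup>2) + 2 * (\<Sum>h<q. (S h)\<^sup>2)"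
    by (simp add: sum.distrib sum_distrib_left)
  also have "(\<Sum>h<q. (S h)\<^sup>2) \<le>
      4 * real m * real (divisor_count q) * real q * harm q * D * (real n + real m * harm m)"
    unfolding S_def m_def using assms by (intro second_moment_incomplete_sums_le)
  also have "\<dots> \<le> 4 * M * real (divisor_count q) * real q * harm q * D * (N + M * harm m)"
    using floor_le assms by (intro mult_mono add_mono mult_nonneg_nonneg add_nonneg_nonneg harm_nonneg) auto
  finally have "real q * divisor_progression_variance M N q \<le>
      real q * (2 * (M + N)\<^sup>2 + 8 * M * real (divisor_count q) * harm q * D * (N + M * harm m))"
    by (simp add: algebra_simps)
  then show ?thesis
    using assms(1) by (simp add: m_def)
qed

lemma divisor_progression_variance_le_power4:
  fixes M N B :: real
  assumes sizes: "M \<ge> 1" "N \<ge> 1" "q > 0" and "B \<ge> 1"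
    and bounds: "\<And>v. 0 < v \<Longrightarrow> v \<le> nat \<lfloor>M\<rfloor> * q \<Longrightarrow> real (divisor_count v) \<le> B \<and> harm v \<le> B"
  shows "divisor_progression_variance M N q \<le> 10 * B ^ 4 * (M + N)\<^sup>2"
proof -
  define L where "L = M + N"
  have "1 \<le> nat \<lfloor>M\<rfloor>"
    using sizes(1) by (simp add: le_nat_floor)
  then have q_bounds: "real (divisor_count q) \<le> B" "harm q \<le> B" and m_bound: "harm (nat \<lfloor>M\<rfloor>) \<le> B"
    using bounds[of q] bounds[of "nat \<lfloor>M\<rfloor>"] sizes by auto
  have "N + M * harm (nat \<lfloor>M\<rfloor>) \<le> N * B + M * B"
    using sizes m_bound \<open>B \<ge> 1\<close> by (intro add_mono mult_left_mono) (simp_all add: mult_le_cancel_left1)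
  then have last_factor: "N + M * harm (nat \<lfloor>M\<rfloor>) \<le> L * B"
    by (simp add: L_def algebra_simps)
  have other_factors: "8 * M * real (divisor_count q) * harm q * B \<le> 8 * L * B * B * B"
    using sizes q_bounds \<open>B \<ge> 1\<close> unfolding L_def
    by (intro mult_right_mono mult_mono) (auto simp: harm_nonneg)
  have "divisor_progression_variance M N q \<le>
      2 * (M + N)\<^sup>2 + 8 * M * real (divisor_count q) * harm q * B * (N + M * harm (nat \<lfloor>M\<rfloor>))"
    using bounds by (intro divisor_progression_variance_le) (use sizes \<open>B \<ge> 1\<close> in auto)
  also have "\<dots> \<le> 2 * L\<^sup>2 * B ^ 4 + 8 * L * B * B * B * (L * B)"
  proof (rule add_mono)
    show "2 * (M + N)\<^sup>2 \<le> 2 * L\<^sup>2 * B ^ 4"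
      using \<open>B \<ge> 1\<close> by (simp add: L_def mult_le_cancel_left1)
    show "8 * M * real (divisor_count q) * harm q * B * (N + M * harm (nat \<lfloor>M\<rfloor>)) \<le>
        8 * L * B * B * B * (L * B)"
      by (rule mult_mono[OF other_factors last_factor])
        (use sizes \<open>B \<ge> 1\<close> in \<open>auto simp: L_def harm_nonneg\<close>)
  qed
  also have "\<dots> = 10 * B ^ 4 * L\<^sup>2"
    by (simp add: power2_eq_square power4_eq_xxxx)
  finally show ?thesis
    by (simp only: L_def)
qed

theorem divisor_progression_variance_powr_bound:
  fixes \<epsilon> :: real
  assumes "\<epsilon> > 0"
  shows "\<exists>K\<ge>0. \<forall>M\<ge>1. \<forall>N\<ge>1. \<forall>q>0.
           divisor_progression_variance M N q \<le> K * (M * real q) powr \<epsilon> * (M + N)\<^sup>2"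
proof -
  obtain C where "C \<ge> 1" and
    C_bound: "\<And>n. n > 0 \<Longrightarrow> real (divisor_count n) \<le> C * real n powr (\<epsilon> / 4) \<and> harm n \<le> C * real n powr (\<epsilon> / 4)"
    using divisor_count_harm_powr_bound[of "\<epsilon> / 4"] assms by auto
  have variance: "divisor_progression_variance M N q \<le> 10 * C ^ 4 * (M * real q) powr \<epsilon> * (M + N)\<^sup>2"
    if sizes: "M \<ge> 1" "N \<ge> 1" "q > 0" for M N q
  proof -
    define B where "B = C * (M * real q) powr (\<epsilon> / 4)"
    have "1 * 1 \<le> M * real q"
      using sizes by (intro mult_mono) auto
    then have "B \<ge> 1"
      using \<open>C \<ge> 1\<close> assms mult_mono[of 1 C 1 "(M * real q) powr (\<epsilon> / 4)"]
      by (simp add: B_def ge_one_powr_ge_zero)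
    have "real (divisor_count v) \<le> B \<and> harm v \<le> B" if v_range: "0 < v" "v \<le> nat \<lfloor>M\<rfloor> * q" for v
    proof -
      have "real v \<le> real (nat \<lfloor>M\<rfloor>) * real q"
        using v_range(2) by (metis of_nat_le_iff of_nat_mult)
      also have "\<dots> \<le> M * real q"
        using sizes(1) by (intro mult_right_mono) auto
      finally have "C * real v powr (\<epsilon> / 4) \<le> B"
        unfolding B_def using \<open>C \<ge> 1\<close> assms by (intro mult_left_mono powr_mono2) auto
      then show ?thesis
        using C_bound[OF v_range(1)] by linarith
    qed
    then have "divisor_progression_variance M N q \<le> 10 * B ^ 4 * (M + N)\<^sup>2"
      using sizes \<open>B \<ge> 1\<close> by (intro divisor_progression_variance_le_power4)
    also have "B ^ 4 = C ^ 4 * (M * real q) powr \<epsilon>"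
      using sizes by (simp add: B_def power_mult_distrib powr_power)
    finally show ?thesis
      by (simp only: mult.assoc)
  qed
  show ?thesis
  proof (intro exI conjI allI impI)
    show "0 \<le> 10 * C ^ 4" by simp
  qed (rule variance)
qed

corollary divisor_progression_variance_balanced_bound:
  fixes \<epsilon> C :: real
  assumes "\<epsilon> > 0" "C > 0"
  shows "\<exists>K\<ge>0. \<forall>M\<ge>1. \<forall>N\<ge>1. \<forall>q>0. M \<le> C * N \<longrightarrow> real q \<le> N powr 2 \<longrightarrow>
           divisor_progression_variance M N q \<le> K * N powr (2 + \<epsilon>)"
proof -
  obtain K where K_nonneg: "K \<ge> 0" and variance: "\<And>M N q. M \<ge> 1 \<Longrightarrow> N \<ge> 1 \<Longrightarrow> q > 0 \<Longrightarrow>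
      divisor_progression_variance M N q \<le> K * (M * real q) powr (\<epsilon> / 3) * (M + N)\<^sup>2"
    using divisor_progression_variance_powr_bound[of "\<epsilon> / 3"] assms(1) by auto
  have "divisor_progression_variance M N q \<le> K * C powr (\<epsilon> / 3) * (C + 1)\<^sup>2 * N powr (2 + \<epsilon>)"
    if sizes: "M \<ge> 1" "N \<ge> 1" "q > 0" "M \<le> C * N" "real q \<le> N powr 2" for M N q
  proof -
    have "M * real q \<le> (C * N) * N powr 2"
      using sizes by (intro mult_mono) auto
    also have "\<dots> = C * N powr 3"
      using sizes(2) by (simp add: powr_numeral power2_eq_square power3_eq_cube)
    finally have "(M * real q) powr (\<epsilon> / 3) \<le> (C * N powr 3) powr (\<epsilon> / 3)"
      using sizes assms(1) by (intro powr_mono2) auto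
    also have "\<dots> = C powr (\<epsilon> / 3) * N powr \<epsilon>"
      using assms(2) by (simp add: powr_mult powr_powr del: powr_numeral)
    finally have product_le: "(M * real q) powr (\<epsilon> / 3) \<le> C powr (\<epsilon> / 3) * N powr \<epsilon>" .
    have "(M + N)\<^sup>2 \<le> ((C + 1) * N)\<^sup>2"
      using sizes by (intro power_mono) (auto simp: algebra_simps)
    also have "\<dots> = (C + 1)\<^sup>2 * N powr 2"
      using sizes(2) by (simp add: power_mult_distrib powr_numeral)
    finally have sum_square_le: "(M + N)\<^sup>2 \<le> (C + 1)\<^sup>2 * N powr 2" .
    have "divisor_progression_variance M N q \<le> K * (M * real q) powr (\<epsilon> / 3) * (M + N)\<^sup>2"
      using sizes(1-3) by (rule variance)
    also have "\<dots> \<le> K * (C powr (\<epsilon> / 3) * N powr \<epsilon>) * ((C + 1)\<^sup>2 * N powr 2)"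
      using K_nonneg by (intro mult_mono product_le sum_square_le) auto
    also have "\<dots> = K * C powr (\<epsilon> / 3) * (C + 1)\<^sup>2 * N powr (2 + \<epsilon>)"
      by (simp add: powr_add mult_ac del: powr_numeral)
    finally show ?thesis .
  qed
  then show ?thesis
    using K_nonneg by (intro exI[of _ "K * C powr (\<epsilon> / 3) * (C + 1)\<^sup>2"]) auto
qed

theorem theorem1p8:
  fixes \<delta> \<epsilon> C1 C2 :: real
  assumes "\<delta> > 0" and "\<epsilon> > 0" and "C1 > 0" and "C2 > 0"
  shows "\<exists>K :: real. \<forall>(M :: real) (N :: real) (q :: nat) (k :: nat).
           M \<ge> 1 \<longrightarrow> N \<ge> 1 \<longrightarrow> C1 * N \<le> M \<longrightarrow> M \<le> C2 * N \<longrightarrow>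
           q \<ge> 1 \<longrightarrow> real q \<le> N powr (2 - \<delta>) \<longrightarrow> k dvd q \<longrightarrow>
           (\<Sum>r\<in>{r. 1 \<le> r \<and> r \<le> q \<and> gcd r q = k}.
              (divisor_progression_sum M N q r - divisor_progression_main M N q k)\<^sup>2)
             \<le> K * N powr (max (7 / 2) (4 - \<delta>) + \<epsilon>) / real q"
proof -
  obtain K where K_nonneg: "K \<ge> 0" and variance: "\<And>M N q. M \<ge> 1 \<Longrightarrow> N \<ge> 1 \<Longrightarrow> q > 0 \<Longrightarrow> M \<le> C2 * N \<Longrightarrow>
      real q \<le> N powr 2 \<Longrightarrow> divisor_progression_variance M N q \<le> K * N powr (2 + \<epsilon>)"
    using divisor_progression_variance_balanced_bound[OF assms(2,4)] by auto
  show ?thesis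
  proof (intro exI[of _ K] allI impI)
    fix M N :: real and q k :: nat
    assume M_bounds: "M \<ge> 1" "M \<le> C2 * N" and N_ge_1: "N \<ge> 1" and q_bounds: "q \<ge> 1" "real q \<le> N powr (2 - \<delta>)"
    have "N powr (2 - \<delta>) \<le> N powr 2"
      using N_ge_1 assms(1) by (intro powr_mono) auto
    have "(\<Sum>r\<in>{r. 1 \<le> r \<and> r \<le> q \<and> gcd r q = k}.
        (divisor_progression_sum M N q r - divisor_progression_main M N q k)\<^sup>2) \<le> divisor_progression_variance M N q"
      unfolding divisor_progression_variance_def by (intro sum_le_included[where i = id]) auto
    also have "\<dots> \<le> K * N powr (2 + \<epsilon>)"
      using M_bounds N_ge_1 q_bounds \<open>N powr (2 - \<delta>) \<le> N powr 2\<close> by (intro variance) auto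
    also have "N powr (2 + \<epsilon>) = N powr (4 - \<delta> + \<epsilon>) / N powr (2 - \<delta>)"
      by (simp flip: powr_diff)
    also have "\<dots> \<le> N powr (max (7 / 2) (4 - \<delta>) + \<epsilon>) / real q"
      using N_ge_1 q_bounds by (intro frac_le powr_mono) auto
    finally show "(\<Sum>r\<in>{r. 1 \<le> r \<and> r \<le> q \<and> gcd r q = k}.
        (divisor_progression_sum M N q r - divisor_progression_main M N q k)\<^sup>2)
          \<le> K * N powr (max (7 / 2) (4 - \<delta>) + \<epsilon>) / real q"
      using K_nonneg by (simp add: mult_left_mono)
  qed
qed

end
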